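(* Let $\mathbf{m}\in\mathcal{R}_M$. Then the optimization problem $$\min_{\mathbf{g}\in\mathbb{R}^N}\ \sum_{l=1}^N \Delta v_l w_l g_l\log(w_l g_l)+\lambda\sum_{l=1}^N|g_l|\quad\text{subject to}\quad \hat{\mathbf{A}}\mathbf{g}=\mathbf{m},\quad g_l\ge 0\ (l=1,\ldots,N)$$ has a unique solution $\mathbf{g}^{\ast}$, and this solution is positive, i.e. $g^{\ast}_l>0$ for every $l=1,\ldots,N$ (equivalently $f^{\ast}_l:=w_lg^{\ast}_l>0$ for every $l$).
   Context: Fixed data: integers $d\ge1$, $N$, $M\ge 1$; velocity nodes $\mathbf{v}_1,\ldots,\mathbf{v}_N\in\mathbb{R}^d$ with components $v_{l,i}$; quadrature weights $\Delta v_1,\ldots,\Delta v_N>0$; multi-indices $\boldsymbol{\alpha}_1,\ldots,\boldsymbol{\alpha}_M\in\mathbb{N}_0^d$; a parameter $\lambda\ge0$. Put $p_k(\mathbf{v})=\prod_{i=1}^d v_i^{\alpha_{k,i}}$ and define the moment measurement matrix $\mathbf{A}\in\mathbb{R}^{M\times N}$ by $\mathbf{A}_{kl}=\Delta v_l\,p_k(\mathbf{v}_l)$. Standing assumptions: $\mathbf{A}$, the nodes and the $\Delta v_l$ are fixed; $N>M$ and $\mathrm{rank}(\mathbf{A})=M$; the zero multi-index is among the $\boldsymbol{\alpha}_k$ (so the density $\sum_l\Delta v_lf_l$ is a constrained moment); the weighting $\mathbf{w}=(w_1,\ldots,w_N)$ satisfies $w_l>0$ for all $l$. Further, $\hat{\mathbf{A}}_{kl}=\mathbf{A}_{kl}w_l$,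 the realizability cone is $\mathcal{R}_M=\{\mathbf{A}\mathbf{f}:\mathbf{f}\in\mathbb{R}^N,\ f_l>0\ \forall l\}\subset\mathbb{R}^M$, and the convention $0\log0=0$ is used. *)

theory Defs
  imports "HOL-Analysis.Analysis"
begin

text \<open>
  The index types \<open>'d\<close>, \<open>'n\<close>, \<open>'m\<close> play the roles of \<open>{1..d}\<close>, \<open>{1..N}\<close>, \<open>{1..M}\<close>.
  The node \<open>v $ l\<close> is a vector in \<open>real ^ 'd\<close>, and \<open>\<alpha> $ k\<close> is a multi-index in \<open>nat ^ 'd\<close>.
\<close>

definition moment_monomial :: "nat ^ 'd \<Rightarrow> real ^ 'd \<Rightarrow> real" where
  "moment_monomial a x = (\<Prod>i\<in>UNIV. (x $ i) ^ (a $ i))"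

definition moment_matrix ::
    "real ^ 'd ^ 'n \<Rightarrow> real ^ 'n \<Rightarrow> nat ^ 'd ^ 'm \<Rightarrow> real ^ 'n ^ 'm" where
  "moment_matrix v \<Delta>v \<alpha> = (\<chi> k l. \<Delta>v $ l * moment_monomial (\<alpha> $ k) (v $ l))"

definition weighted_matrix :: "real ^ 'n ^ 'm \<Rightarrow> real ^ 'n \<Rightarrow> real ^ 'n ^ 'm" where
  "weighted_matrix A w = (\<chi> k l. A $ k $ l * w $ l)"

definition realizability_cone :: "real ^ 'n ^ 'm \<Rightarrow> (real ^ 'm) set" where
  "realizability_cone A = {A *v f | f. \<forall>l. f $ l > 0}"

text \<open>The convention \<open>0 log 0 = 0\<close> holds automatically, since \<open>0 * ln 0 = 0\<close>.\<close>

definition entropy_objective ::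
    "real ^ 'n \<Rightarrow> real ^ 'n \<Rightarrow> real \<Rightarrow> real ^ 'n \<Rightarrow> real" where
  "entropy_objective \<Delta>v w lam g =
     (\<Sum>l\<in>UNIV. \<Delta>v $ l * ((w $ l * g $ l) * ln (w $ l * g $ l))) + lam * (\<Sum>l\<in>UNIV. \<bar>g $ l\<bar>)"

definition feasible :: "real ^ 'n ^ 'm \<Rightarrow> real ^ 'n \<Rightarrow> real ^ 'm \<Rightarrow> real ^ 'n \<Rightarrow> bool" where
  "feasible A w m g \<longleftrightarrow> weighted_matrix A w *v g = m \<and> (\<forall>l. g $ l \<ge> 0)"

end

theory Submission
  imports Defs "HOL-Real_Asymp.Real_Asymp"
begin

text \<open>
  The density constraint bounds every component of a feasible vector, so the feasible set is
  compact and a minimizer exists; strict convexity of \<open>x ln x\<close> makes it unique. The derivative of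
  \<open>x ln x\<close> at \<open>0\<close> is \<open>- \<infinity>\<close>: moving from a minimizer \<open>g\<close> with a vanishing component towards a
  positive feasible vector \<open>h\<close> by a step \<open>t\<close> changes the objective by at most \<open>t (D + c ln t)\<close>,
  where \<open>D\<close> is the difference of the objective values and \<open>c > 0\<close> is the mass of \<open>h\<close> on the zero
  set of \<open>g\<close>. This is negative for small \<open>t\<close>, a contradiction.
\<close>

section \<open>Tangents, convexity and continuity of x ln x on the nonnegative reals\<close>

lemma xlnx_above_tangent:
  fixes s z :: real
  assumes "s \<ge> 0" "z > 0"
  shows "s * ln z + s - z \<le> s * ln s"
    and "s \<noteq> z \<Longrightarrow> s * ln z + s - z < s * ln s"
proof -
  \<comment> \<open>The left side is the value at \<open>s\<close> of the tangent to x ln x at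
    \<open>z\<close>, whose slope is \<open>ln z + 1\<close>. For \<open>s > 0\<close> the gap is
    \<open>s\<close> times that in ln u < u - 1 at u = \<open>z / s\<close>; for
    \<open>s = 0\<close> it is \<open>z\<close>.\<close>
  have strict: "s * ln z + s - z < s * ln s" if "s \<noteq> z"
  proof (cases "s = 0")
    case False
    with assms have s: "s > 0" by simp
    have "ln (z / s) < z / s - 1"
      using ln_le_minus_one[of "z / s"] ln_eq_minus_one[of "z / s"] s assms(2) that by force
    then have "s * ln (z / s) < s * (z / s - 1)" using s by simp
    then show ?thesis using s assms(2) by (simp add: ln_div algebra_simps)
  qed (use assms in auto)
  then show "s \<noteq> z \<Longrightarrow> s * ln z + s - z < s * ln s" .
  show "s * ln z + s - z \<le> s * ln s" using strict by (cases "s = z") auto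
qed

text \<open>The tangent at the intermediate point lies strictly below the graph at \<open>x\<close>
  and weakly below it at \<open>y\<close>; averaging the two tangent values gives back the function
  value at the intermediate point. That point is positive, since it could vanish only for
  \<open>x = y = 0\<close>.\<close>

lemma xlnx_strictly_convex:
  fixes x y t :: real
  assumes "x \<ge> 0" "y \<ge> 0" "x \<noteq> y" "0 < t" "t < 1"
  shows "((1 - t) * x + t * y) * ln ((1 - t) * x + t * y)
           < (1 - t) * (x * ln x) + t * (y * ln y)"
proof -
  define z where "z = (1 - t) * x + t * y"
  have z: "z > 0"
  proof (cases "x = 0")
    case False
    with assms show ?thesis unfolding z_def by (simp add: add_pos_nonneg)
  qed (use assms in \<open>simp add: z_def\<close>)
  have "z - x = t * (y - x)" by (simp add: z_def algebra_simps)
  with assms have "x \<noteq> z" by auto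
  then have "(1 - t) * (x * ln z + x - z) < (1 - t) * (x * ln x)"
    using xlnx_above_tangent(2)[OF assms(1) z] assms(5) by simp
  moreover have "t * (y * ln z + y - z) \<le> t * (y * ln y)"
    using xlnx_above_tangent(1)[OF assms(2) z] assms(4) by simp
  moreover have "(1 - t) * (x * ln z + x - z) + t * (y * ln z + y - z)
      = ((1 - t) * x + t * y) * ln z + ((1 - t) * x + t * y) - z"
    by (simp add: algebra_simps)
  ultimately show ?thesis by (simp flip: z_def)
qed

text \<open>For \<open>x = 0\<close> this is an equality, as ln (ty) = ln t + ln y for
  \<open>y > 0\<close>. The extra term is negative for \<open>y > 0\<close> and of order t ln t,
  which beats any linear term as t tends to 0: a quantitative form of the infinite slope at
  0.\<close>

lemma xlnx_convex_with_defect: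
  fixes x y t :: real
  assumes "x \<ge> 0" "y \<ge> 0" "0 < t" "t < 1"
  shows "((1 - t) * x + t * y) * ln ((1 - t) * x + t * y)
           \<le> (1 - t) * (x * ln x) + t * (y * ln y) + t * ln t * (if x = 0 then y else 0)"
proof (cases "x = 0")
  case True
  with assms show ?thesis by (cases "y = 0") (auto simp: ln_mult algebra_simps)
next
  case False
  then show ?thesis
    using xlnx_strictly_convex[OF assms(1,2) _ assms(3,4)]
    by (cases "x = y") (auto simp: algebra_simps)
qed

lemma continuous_on_xlnx: "continuous_on {0..} (\<lambda>x::real. x * ln x)"
proof (rule continuous_on_eq_continuous_within[THEN iffD2], rule ballI)
  fix x :: real
  assume "x \<in> {0..}"
  show "continuous (at x within {0..}) (\<lambda>x. x * ln x)"
  proof (cases "x = 0")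
    case True
    \<comment> \<open>Only the endpoint needs a limit, which agrees with the convention 0 log 0 =
      0.\<close>
    have "((\<lambda>x::real. x * ln x) \<longlongrightarrow> 0) (at_right 0)" by real_asymp
    then show ?thesis
      using True by (simp add: continuous_within at_within_Ici_at_right)
  qed (auto intro!: continuous_intros)
qed

section \<open>Continuity and convexity of the entropy objective\<close>

lemma entropy_objective_alt:
  "entropy_objective \<Delta>v w lam g =
     (\<Sum>l\<in>UNIV. \<Delta>v $ l * ((w $ l * g $ l) * ln (w $ l * g $ l)) + lam * \<bar>g $ l\<bar>)"
  by (simp add: entropy_objective_def sum.distrib sum_distrib_left)

context
  fixes \<Delta>v w :: "real ^ 'n"
  assumes dv_pos: "\<And>l. \<Delta>v $ l > 0" and w_pos: "\<And>l. w $ l > 0"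
begin

lemma continuous_on_entropy_objective:
  "continuous_on {g. \<forall>l. g $ l \<ge> 0} (entropy_objective \<Delta>v w lam)"
proof -
  have "continuous_on {g. \<forall>l. g $ l \<ge> 0} (\<lambda>g. (w $ l * g $ l) * ln (w $ l * g $ l))" for l
    by (rule continuous_on_compose2[OF continuous_on_xlnx, where f = "\<lambda>g. w $ l * g $ l"])
      (auto intro!: continuous_intros simp: w_pos less_imp_le)
  then show ?thesis unfolding entropy_objective_def
    by (intro continuous_on_add continuous_on_sum continuous_on_mult_left)
      (auto intro!: continuous_intros)
qed

text \<open>On the nonnegative orthant the penalty is linear and preserves convex combinations
  exactly. Strictness comes from the entropy term in one coordinate where \<open>g\<close> and
  \<open>h\<close> differ.\<close>

lemma entropy_objective_strictly_convex:
  fixes g h :: "real ^ 'n"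
  assumes g: "\<And>l. g $ l \<ge> 0" and h: "\<And>l. h $ l \<ge> 0" and "g \<noteq> h" and t: "0 < t" "t < 1"
  shows "entropy_objective \<Delta>v w lam ((1 - t) *\<^sub>R g + t *\<^sub>R h)
           < (1 - t) * entropy_objective \<Delta>v w lam g + t * entropy_objective \<Delta>v w lam h"
proof -
  let ?x = "\<lambda>g l. w $ l * g $ l"
  let ?k = "(1 - t) *\<^sub>R g + t *\<^sub>R h"
  let ?e = "\<lambda>g l. \<Delta>v $ l * (?x g l * ln (?x g l)) + lam * \<bar>g $ l\<bar>"
  have comb: "?x ?k l = (1 - t) * ?x g l + t * ?x h l" for l by (simp add: algebra_simps)
  have abs: "\<bar>?k $ l\<bar> = (1 - t) * \<bar>g $ l\<bar> + t * \<bar>h $ l\<bar>" for l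
    using g[of l] h[of l] t by simp
  have nonneg: "?x g l \<ge> 0" "?x h l \<ge> 0" for l using w_pos[of l] g h by auto
  have strict: "?e ?k l < (1 - t) * ?e g l + t * ?e h l" if "g $ l \<noteq> h $ l" for l
  proof -
    have "?x g l \<noteq> ?x h l" using that w_pos[of l] by simp
    from mult_strict_left_mono[OF xlnx_strictly_convex[OF nonneg this t] dv_pos[of l]]
    show ?thesis unfolding comb abs by (simp add: algebra_simps)
  qed
  have weak: "?e ?k l \<le> (1 - t) * ?e g l + t * ?e h l" for l
  proof (cases "g $ l = h $ l")
    case True
    then have "?k $ l = h $ l" by (simp add: algebra_simps)
    with True show ?thesis by (simp add: algebra_simps)
  qed (use strict in \<open>auto intro: less_imp_le\<close>)
  from \<open>g \<noteq> h\<close> obtain i where "g $ i \<noteq> h $ i" by (auto simp: vec_eq_iff)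
  then have "(\<Sum>l\<in>UNIV. ?e ?k l) < (\<Sum>l\<in>UNIV. (1 - t) * ?e g l + t * ?e h l)"
    using weak strict by (intro sum_strict_mono_ex1) auto
  then show ?thesis
    by (simp only: entropy_objective_alt sum.distrib flip: sum_distrib_left)
qed

text \<open>The coordinatewise defects add up to the mass of \<open>h\<close> on the zero set of
  \<open>g\<close>. This makes a step away from the boundary of the orthant profitable.\<close>

lemma entropy_objective_convex_with_defect:
  fixes g h :: "real ^ 'n"
  assumes g: "\<And>l. g $ l \<ge> 0" and h: "\<And>l. h $ l \<ge> 0" and t: "0 < t" "t < 1"
  shows "entropy_objective \<Delta>v w lam ((1 - t) *\<^sub>R g + t *\<^sub>R h)
           \<le> (1 - t) * entropy_objective \<Delta>v w lam g + t * entropy_objective \<Delta>v w lam h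
             + t * ln t * (\<Sum>l | g $ l = 0. \<Delta>v $ l * (w $ l * h $ l))"
proof -
  let ?x = "\<lambda>g l. w $ l * g $ l"
  let ?k = "(1 - t) *\<^sub>R g + t *\<^sub>R h"
  let ?e = "\<lambda>g l. \<Delta>v $ l * (?x g l * ln (?x g l)) + lam * \<bar>g $ l\<bar>"
  let ?d = "\<lambda>l. if g $ l = 0 then \<Delta>v $ l * ?x h l else 0"
  have comb: "?x ?k l = (1 - t) * ?x g l + t * ?x h l" for l by (simp add: algebra_simps)
  have abs: "\<bar>?k $ l\<bar> = (1 - t) * \<bar>g $ l\<bar> + t * \<bar>h $ l\<bar>" for l
    using g[of l] h[of l] t by simp
  have nonneg: "?x g l \<ge> 0" "?x h l \<ge> 0" for l using w_pos[of l] g h by auto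
  have "?e ?k l \<le> (1 - t) * ?e g l + t * ?e h l + t * ln t * ?d l" for l
  proof -
    \<comment> \<open>Positive weights let the scalar case distinction on
      \<open>w $ l * g $ l\<close> be read as one on \<open>g $ l\<close>.\<close>
    have zero: "?x g l = 0 \<longleftrightarrow> g $ l = 0" using w_pos[of l] by simp
    show ?thesis
      using mult_left_mono[OF xlnx_convex_with_defect[OF nonneg(1)[of l] nonneg(2)[of l] t]
          less_imp_le[OF dv_pos[of l]]]
      unfolding comb abs zero by (cases "g $ l = 0") (simp_all add: algebra_simps)
  qed
  then have "(\<Sum>l\<in>UNIV. ?e ?k l)
      \<le> (\<Sum>l\<in>UNIV. (1 - t) * ?e g l + t * ?e h l + t * ln t * ?d l)"
    by (rule sum_mono)
  moreover have "(\<Sum>l\<in>UNIV. ?d l) = (\<Sum>l | g $ l = 0. \<Delta>v $ l * ?x h l)"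
    by (simp add: sum.If_cases)
  ultimately show ?thesis
    by (simp only: entropy_objective_alt sum.distrib flip: sum_distrib_left)
qed

section \<open>Positivity and uniqueness of minimizers\<close>

lemma feasible_convex_combination:
  assumes "feasible A w m g" "feasible A w m h" "0 \<le> t" "t \<le> 1"
  shows "feasible A w m ((1 - t) *\<^sub>R g + t *\<^sub>R h)"
  unfolding feasible_def
proof
  show "weighted_matrix A w *v ((1 - t) *\<^sub>R g + t *\<^sub>R h) = m"
    using assms(1,2)
    by (simp add: feasible_def matrix_vector_right_distrib matrix_vector_mult_scaleR
        flip: scaleR_add_left)
  show "\<forall>l. ((1 - t) *\<^sub>R g + t *\<^sub>R h) $ l \<ge> 0"
    using assms by (simp add: feasible_def)
qed

lemma minimizer_positive:
  assumes min: "is_arg_min (entropy_objective \<Delta>v w lam) (feasible A w m) g"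
    and h: "feasible A w m h" "\<And>l. h $ l > 0"
  shows "g $ l > 0"
proof (rule ccontr)
  let ?J = "entropy_objective \<Delta>v w lam"
  define c where "c = (\<Sum>l | g $ l = 0. \<Delta>v $ l * (w $ l * h $ l))"
  define D where "D = ?J h - ?J g"
  \<comment> \<open>Chosen so that \<open>D + c * ln t = -1\<close>: the step then lowers the
    objective by at least \<open>t\<close>.\<close>
  define t where "t = exp (- (D + 1) / c)"
  from min have fg: "feasible A w m g" and le: "\<And>k. feasible A w m k \<Longrightarrow> ?J g \<le> ?J k"
    by (auto simp: is_arg_min_linorder)
  from fg have g: "\<And>l. g $ l \<ge> 0" by (simp add: feasible_def)
  assume "\<not> g $ l > 0"
  with g[of l] have "l \<in> {l. g $ l = 0}" by simp
  then have c: "c > 0" unfolding c_def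
    using dv_pos w_pos h(2) by (intro sum_pos) auto
  \<comment> \<open>Minimality of \<open>g\<close> makes the exponent in \<open>t\<close> negative,
    so that \<open>t < 1\<close>.\<close>
  have "D \<ge> 0" using le[OF h(1)] by (simp add: D_def)
  with c have t: "0 < t" "t < 1" by (auto simp: t_def divide_neg_pos)
  have "?J g \<le> ?J ((1 - t) *\<^sub>R g + t *\<^sub>R h)"
    using le feasible_convex_combination[OF fg h(1)] t by simp
  also have "\<dots> \<le> (1 - t) * ?J g + t * ?J h + t * ln t * c"
    unfolding c_def
    by (rule entropy_objective_convex_with_defect) (use g h(2) t in \<open>auto intro: less_imp_le\<close>)
  also have "\<dots> = ?J g + t * (D + c * ln t)" by (simp add: D_def algebra_simps)
  also have "c * ln t = - (D + 1)" using c by (simp add: t_def)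
  finally show False using t by simp
qed

lemma minimizer_unique:
  assumes "is_arg_min (entropy_objective \<Delta>v w lam) (feasible A w m) g"
    and "is_arg_min (entropy_objective \<Delta>v w lam) (feasible A w m) h"
  shows "g = h"
proof (rule ccontr)
  let ?J = "entropy_objective \<Delta>v w lam"
  \<comment> \<open>The midpoint of two distinct minimizers would be feasible and strictly better.
    The coefficient \<open>1 - 1/2\<close> is left unevaluated to match the convexity
    lemmas.\<close>
  let ?k = "(1 - 1/2) *\<^sub>R g + (1/2) *\<^sub>R h"
  from assms have fg: "feasible A w m g" and fh: "feasible A w m h"
    and le: "\<And>k. feasible A w m k \<Longrightarrow> ?J g \<le> ?J k" "\<And>k. feasible A w m k \<Longrightarrow> ?J h \<le> ?J k"
    by (auto simp: is_arg_min_linorder)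
  assume "g \<noteq> h"
  then have "?J ?k < (1 - 1/2) * ?J g + 1/2 * ?J h"
    by (intro entropy_objective_strictly_convex) (use fg fh in \<open>auto simp: feasible_def\<close>)
  moreover have "feasible A w m ?k"
    by (rule feasible_convex_combination[OF fg fh]) auto
  ultimately show False using le[of ?k] by simp
qed

section \<open>Compactness of the feasible set and existence of a minimizer\<close>

lemma closed_feasible: "closed {g. feasible A w m g}"
proof -
  have "closed {g. weighted_matrix A w *v g = m}"
    by (intro closed_Collect_eq continuous_intros)
  moreover have "closed {g :: real ^ 'n. \<forall>l. g $ l \<ge> 0}"
    by (intro closed_Collect_all closed_Collect_le continuous_intros)
  ultimately show ?thesis
    unfolding feasible_def Collect_conj_eq by (rule closed_Int)
qed

text \<open>Row \<open>k\<close> prescribes the total mass \<open>m $ k\<close>. It is a sum of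
  nonnegative terms, so each term is at most \<open>m $ k\<close>, which confines \<open>g\<close>
  to a box.\<close>

lemma bounded_feasible:
  assumes "A $ k = \<Delta>v"
  shows "bounded {g. feasible A w m g}"
proof (rule bounded_subset[OF bounded_cbox])
  show "{g. feasible A w m g} \<subseteq> cbox 0 (\<chi> l. m $ k / (\<Delta>v $ l * w $ l))"
  proof
    fix g assume "g \<in> {g. feasible A w m g}"
    then have mk: "(weighted_matrix A w *v g) $ k = m $ k" and g: "\<And>l. g $ l \<ge> 0"
      by (auto simp: feasible_def)
    have "g $ l \<le> m $ k / (\<Delta>v $ l * w $ l)" for l
    proof -
      have "\<Delta>v $ l * w $ l * g $ l \<le> (\<Sum>l\<in>UNIV. \<Delta>v $ l * w $ l * g $ l)"
        using less_imp_le[OF dv_pos] less_imp_le[OF w_pos] g by (intro member_le_sum) auto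
      also have "\<dots> = m $ k"
        using mk assms by (simp add: weighted_matrix_def matrix_vector_mult_def)
      finally show ?thesis
        using dv_pos[of l] w_pos[of l] by (simp add: field_simps)
    qed
    then show "g \<in> cbox 0 (\<chi> l. m $ k / (\<Delta>v $ l * w $ l))"
      using g by (simp add: mem_box_cart)
  qed
qed

lemma minimizer_exists:
  assumes "A $ k = \<Delta>v" "feasible A w m h"
  shows "\<exists>g. is_arg_min (entropy_objective \<Delta>v w lam) (feasible A w m) g"
proof -
  have "compact {g. feasible A w m g}"
    using closed_feasible bounded_feasible[OF assms(1)] by (simp add: compact_eq_bounded_closed)
  moreover have "continuous_on {g. feasible A w m g} (entropy_objective \<Delta>v w lam)"
    by (rule continuous_on_subset[OF continuous_on_entropy_objective]) (auto simp: feasible_def)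
  \<comment> \<open>The vector \<open>h\<close> supplies the nonemptiness required for attaining the
    infimum.\<close>
  ultimately show ?thesis
    using continuous_attains_inf[of "{g. feasible A w m g}"] assms(2)
    by (auto simp: is_arg_min_linorder)
qed

section \<open>Positive feasible vectors from realizability, and the conclusion\<close>

lemma realizable_imp_positive_feasible:
  assumes "m \<in> realizability_cone A"
  obtains h where "feasible A w m h" "\<And>l. h $ l > 0"
proof -
  from assms obtain f where m: "m = A *v f" and f: "\<And>l. f $ l > 0"
    by (auto simp: realizability_cone_def)
  \<comment> \<open>Dividing by the weights undoes the column scaling in
    \<open>weighted_matrix A w\<close>.\<close>
  define h where "h = (\<chi> l. f $ l / w $ l)"
  have pos: "h $ l > 0" for l using f w_pos by (simp add: h_def)
  have "w $ l \<noteq> 0" for l using w_pos[of l] by simp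
  then have "weighted_matrix A w *v h = m"
    by (simp add: m h_def weighted_matrix_def matrix_vector_mult_def)
  with pos have "feasible A w m h" by (simp add: feasible_def less_imp_le)
  with pos show ?thesis by (rule that[rotated])
qed

end

theorem theorem1:
  fixes v :: "real ^ 'd ^ 'n"
    and \<Delta>v w :: "real ^ 'n"
    and \<alpha> :: "nat ^ 'd ^ 'm"
    and lam :: real
    and m :: "real ^ 'm"
    and A :: "real ^ 'n ^ 'm"
  defines "A \<equiv> moment_matrix v \<Delta>v \<alpha>"
  assumes "\<And>l. \<Delta>v $ l > 0"
    and "lam \<ge> 0"
    and "CARD('n) > CARD('m)"
    and "rank A = CARD('m)"
    and "\<exists>k. \<forall>i. \<alpha> $ k $ i = 0"
    and "\<And>l. w $ l > 0"
    and "m \<in> realizability_cone A"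
  shows "\<exists>g. (\<forall>h. is_arg_min (entropy_objective \<Delta>v w lam) (feasible A w m) h \<longleftrightarrow> h = g)
            \<and> (\<forall>l. g $ l > 0) \<and> (\<forall>l. w $ l * g $ l > 0)"
proof -
  note pos = \<open>\<And>l. \<Delta>v $ l > 0\<close> \<open>\<And>l. w $ l > 0\<close>
  obtain k where "\<forall>i. \<alpha> $ k $ i = 0" using assms(6) by blast
  \<comment> \<open>The monomial of the zero multi-index is constantly 1, so its row consists of the
    bare quadrature weights: this is the density constraint.\<close>
  then have row: "A $ k = \<Delta>v"
    by (simp add: A_def moment_matrix_def moment_monomial_def vec_eq_iff)
  obtain h where h: "feasible A w m h" "\<And>l. h $ l > 0"
    using realizable_imp_positive_feasible[OF pos assms(8)] by blast
  obtain g where g: "is_arg_min (entropy_objective \<Delta>v w lam) (feasible A w m) g"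
    using minimizer_exists[OF pos row h(1)] by blast
  have "g $ l > 0" for l using minimizer_positive[OF pos g h] .
  then show ?thesis
    using g minimizer_unique[OF pos] pos(2) by (metis mult_pos_pos)
qed

end
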